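(* Let $b\ge2$ be an integer, let $\boldsymbol{a}_0,\dots,\boldsymbol{a}_{n-1}\in[0,1)^d$ be arbitrary points, and let $\boldsymbol{x}_0,\dots,\boldsymbol{x}_{n-1}$ be obtained from them by base-$b$ nested uniform scrambling (or by base-$b$ random linear scrambling with digital shift). Let $f\in L^2[0,1)^d$, let $j\in\{1,\dots,d\}$, and let $g(\boldsymbol{x})=\int_0^1 f(x_1,\dots,x_{j-1},y,x_{j+1},\dots,x_d)\,\mathrm{d}y$ for $\boldsymbol{x}\in[0,1)^d$. Then $$\operatorname{Var}\Bigl(\frac1n\sum_{i=0}^{n-1}g(\boldsymbol{x}_i)\Bigr)\le\operatorname{Var}\Bigl(\frac1n\sum_{i=0}^{n-1}f(\boldsymbol{x}_i)\Bigr).$$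
   Context: Nested uniform scrambling in base $b$: for a point $\boldsymbol{a}\in[0,1)^d$ write each coordinate as $a_j=\sum_{k\ge1}a_{jk}b^{-k}$ (base-$b$ digits, expansion not ending in infinitely many $b-1$'s). The scrambled point has coordinates $x_j=\sum_{k\ge1}x_{jk}b^{-k}$ with $x_{j1}=\pi_j(a_{j1})$ and $x_{jk}=\pi_{j,a_{j1}\cdots a_{j,k-1}}(a_{jk})$ for $k\ge2$, where all the permutations $\pi_j,\pi_{j,a_{j1}\cdots a_{j,k-1}}$ of $\{0,\dots,b-1\}$ are mutually independent and uniformly distributed, and the same random permutations are applied to all $n$ points. Random linear scrambling with digital shift (Matoušek) in base $b$ (prime $b$): $x_{jk}=\sum_{l=1}^k L^{(j)}_{kl}a_{jl}+c_{jk}\bmod b$, with $L^{(j)}_{kk}$ uniform on $\{1,\dots,b-1\}$, $L^{(j)}_{kl}$ ($l<k$) and $c_{jk}$ uniform on $\{0,\dots,b-1\}$, all independent, the same for all points. The variances are taken over the randomness of the scrambling. *)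

theory Defs
  imports "HOL-Probability.Probability" "HOL-Combinatorics.Permutations"
begin

text \<open>The k-th base-b digit (k >= 1) of t in [0,1), i.e. the expansion not ending
  in infinitely many (b-1)'s.\<close>
definition digit :: "nat \<Rightarrow> real \<Rightarrow> nat \<Rightarrow> nat" where
  "digit b t k = nat \<lfloor>t * real b ^ k\<rfloor> mod b"

definition unit_cube :: "(real ^ 'd) set" where
  "unit_cube = {x. \<forall>k. 0 \<le> x $ k \<and> x $ k < 1}"

definition Var :: "'a measure \<Rightarrow> ('a \<Rightarrow> real) \<Rightarrow> real" where
  "Var M X = (\<integral>\<omega>. (X \<omega> - (\<integral>\<omega>'. X \<omega>' \<partial>M))\<^sup>2 \<partial>M)"

text \<open>Nested uniform scrambling: pi (j, [a_j1,...,a_j(k-1)]) is the permutation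
  applied to the k-th digit of coordinate j.\<close>
definition nested_scramble ::
  "nat \<Rightarrow> ('d \<times> nat list \<Rightarrow> nat \<Rightarrow> nat) \<Rightarrow> real ^ 'd \<Rightarrow> real ^ 'd" where
  "nested_scramble b \<pi> a = (\<chi> j. \<Sum>k. real (\<pi> (j, map (digit b (a $ j)) [1..<Suc k])
        (digit b (a $ j) (Suc k))) / real b ^ Suc k)"

definition nested_space :: "nat \<Rightarrow> ('d \<times> nat list \<Rightarrow> nat \<Rightarrow> nat) measure" where
  "nested_space b = PiM ((UNIV :: 'd set) \<times> lists {..<b})
      (\<lambda>_. measure_pmf (pmf_of_set {p. p permutes {..<b}}))"

text \<open>Random linear scrambling with digital shift: L (j,k,l) = L^(j)_{kl} for
  1 <= l <= k, and c (j,k) = c_{jk} for k >= 1.\<close>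
definition linear_scramble ::
  "nat \<Rightarrow> ('d \<times> nat \<times> nat \<Rightarrow> nat) \<times> ('d \<times> nat \<Rightarrow> nat) \<Rightarrow> real ^ 'd \<Rightarrow> real ^ 'd" where
  "linear_scramble b \<omega> a = (\<chi> j. \<Sum>k. real (((\<Sum>l=1..Suc k. fst \<omega> (j, Suc k, l) * digit b (a $ j) l)
        + snd \<omega> (j, Suc k)) mod b) / real b ^ Suc k)"

definition linear_space ::
  "nat \<Rightarrow> (('d \<times> nat \<times> nat \<Rightarrow> nat) \<times> ('d \<times> nat \<Rightarrow> nat)) measure" where
  "linear_space b =
     (PiM {(j, k, l). 1 \<le> k \<and> 1 \<le> l \<and> l \<le> k}
        (\<lambda>(j, k, l). measure_pmf (pmf_of_set (if l = k then {1..<b} else {..<b}))))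
     \<Otimes>\<^sub>M
     (PiM {(j, k). 1 \<le> k} (\<lambda>_. measure_pmf (pmf_of_set {..<b})))"

definition avg_coord :: "(real ^ 'd \<Rightarrow> real) \<Rightarrow> 'd \<Rightarrow> real ^ 'd \<Rightarrow> real" where
  "avg_coord f j x = (LINT y:{0..1}|lborel. f (\<chi> k. if k = j then y else x $ k))"

end

theory Submission
  imports Defs
begin

text \<open>Let \<open>g = avg_coord f j\<close>. The scrambles of distinct coordinates are independent, and coordinate
  \<open>j\<close> of each scrambled point is uniform on $[0,1]$ given all the other coordinates. Hence the average
  of \<open>g\<close> over the scrambled points is the conditional expectation of the average of \<open>f\<close> given the
  scrambles of all coordinates other than \<open>j\<close>, and conditioning does not increase the variance.
  For random linear scrambling the digital shift alone makes the digits of a point independent and uniform.\<close>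

section \<open>Numbers with independent uniform digits\<close>

text \<open>The scrambled points are strongly dependent, since they share their random permutations
  or matrices. Two facts suffice: the n-tuples of scrambled values belonging to different
  coordinates are independent, and every single coordinate of every single point is uniform. With
  the other coordinates fixed, the average of \<open>f\<close> is a sum over the points, so by
  linearity its integral over coordinate \<open>j\<close> needs only the one-point laws there.
  Uniformity is expressed on the open interval \<open>{0<..<1}\<close>: a scrambled digit string may
  consist of b-1 forever, so the value 1, outside the half-open cube, can occur, but only with
  probability 0. Since integrals default to 0 for non-integrable functions, conditional means are
  identified only almost everywhere, where Fubini provides integrability.\<close>

lemma digit_expansion_Suc:
  fixes d :: "nat \<Rightarrow> nat"
  shows "(\<Sum>k<Suc K. d k * b ^ (Suc K - Suc k)) = b * (\<Sum>k<K. d k * b ^ (K - Suc k)) + d K"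
proof -
  have "(\<Sum>k<K. d k * b ^ (K - k)) = (\<Sum>k<K. b * (d k * b ^ (K - Suc k)))"
    by (intro sum.cong refl) (auto simp: Suc_diff_Suc simp flip: power_Suc)
  then show ?thesis by (simp add: sum_distrib_left)
qed

text \<open>The sum is the integer whose base-b digits, most significant first, are
  \<open>d 0\<close>, ..., \<open>d (K - 1)\<close>. Division with remainder by b splits off the
  last digit uniquely, and the induction handles the quotient.\<close>

lemma digit_expansion_eq_iff:
  fixes d :: "nat \<Rightarrow> nat"
  assumes "\<And>k. d k < b" "v < b ^ K"
  shows "(\<Sum>k<K. d k * b ^ (K - Suc k)) = v \<longleftrightarrow> (\<forall>k<K. d k = v div b ^ (K - Suc k) mod b)"
  using assms(2)
proof (induction K arbitrary: v)
  case (Suc K)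
  have b: "0 < b" using assms(1)[of 0] by simp
  have "v div b < b ^ K" using Suc.prems by (simp add: less_mult_imp_div_less mult.commute)
  note IH = Suc.IH[OF this]
  have "b * N + d K = v \<longleftrightarrow> N = v div b \<and> d K = v mod b" for N
    using assms(1)[of K] by (auto simp: )
  moreover have "v div b div b ^ (K - Suc k) = v div b ^ (K - k)" if "k < K" for k
    using that by (simp add: Suc_diff_Suc flip: div_mult2_eq power_Suc)
  ultimately show ?case
    unfolding digit_expansion_Suc by (simp add: IH less_Suc_eq all_conj_distrib imp_conjR cong: conj_cong)
qed simp

text \<open>Multiplying by b^K moves K digits in front of the point; what remains is a tail between
  0 and the geometric series with all digits b-1, which sums to 1. The upper bound cannot be strict,
  because that extreme tail may occur.\<close>

lemma digit_expansion_bounds: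
  fixes d :: "nat \<Rightarrow> nat"
  assumes b: "2 \<le> b" and d: "\<And>k. d k < b"
  defines "x \<equiv> (\<Sum>k. real (d k) / real b ^ Suc k)"
  shows "real (\<Sum>k<K. d k * b ^ (K - Suc k)) \<le> x * real b ^ K"
    and "x * real b ^ K \<le> real (\<Sum>k<K. d k * b ^ (K - Suc k)) + 1"
proof -
  have geo: "(\<lambda>k. real (b - 1) / real b ^ Suc k) sums 1"
  proof -
    have "(\<lambda>k. (real (b - 1) / real b) * (1 / real b) ^ k) sums ((real (b - 1) / real b) * (1 / (1 - 1 / real b)))"
      using b by (intro sums_mult geometric_sums) auto
    moreover have "(real (b - 1) / real b) * (1 / (1 - 1 / real b)) = 1"
      using b by (simp add: field_simps of_nat_diff)
    ultimately show ?thesis by (simp only: times_divide_times_eq power_divide power_one mult_1_right power_Suc)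
  qed
  have le: "real (d k) / real b ^ Suc m \<le> real (b - 1) / real b ^ Suc m" for k m
    using d[of k] by (intro divide_right_mono) auto
  have sm: "summable (\<lambda>k. real (d k) / real b ^ Suc k)"
    by (rule summable_comparison_test'[OF sums_summable[OF geo], of 0])
       (use le in auto)
  define t where "t = (\<Sum>k. real (d (k + K)) / real b ^ Suc k)"
  have smt: "summable (\<lambda>k. real (d (k + K)) / real b ^ Suc k)"
    by (rule summable_comparison_test'[OF sums_summable[OF geo], of 0])
       (use le in auto)
  have "x = (\<Sum>k. real (d (k + K)) / real b ^ Suc (k + K)) + (\<Sum>k<K. real (d k) / real b ^ Suc k)"
    unfolding x_def by (rule suminf_split_initial_segment[OF sm])
  also have "(\<lambda>k. real (d (k + K)) / real b ^ Suc (k + K))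
      = (\<lambda>k. (real (d (k + K)) / real b ^ Suc k) * (1 / real b ^ K))"
    by (auto simp: power_add)
  also have "(\<Sum>k. (real (d (k + K)) / real b ^ Suc k) * (1 / real b ^ K)) = t * (1 / real b ^ K)"
    unfolding t_def by (rule suminf_mult2[OF smt, symmetric])
  finally have "x * real b ^ K = t + (\<Sum>k<K. real (d k) / real b ^ Suc k) * real b ^ K"
    using b by (simp add: field_simps)
  also have "(\<Sum>k<K. real (d k) / real b ^ Suc k) * real b ^ K = (\<Sum>k<K. real (d k) * real b ^ (K - Suc k))"
    unfolding sum_distrib_right using b
    by (intro sum.cong refl) (auto simp: power_diff field_simps)
  finally have eq: "x * real b ^ K = t + real (\<Sum>k<K. d k * b ^ (K - Suc k))"
    by simp
  have "0 \<le> t" unfolding t_def by (intro suminf_nonneg smt) auto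
  moreover have "t \<le> 1"
    unfolding t_def sums_unique[OF geo] by (intro suminf_le le smt sums_summable[OF geo])
  ultimately show "real (\<Sum>k<K. d k * b ^ (K - Suc k)) \<le> x * real b ^ K"
    and "x * real b ^ K \<le> real (\<Sum>k<K. d k * b ^ (K - Suc k)) + 1"
    unfolding eq by auto
qed

text \<open>The integer \<open>N K\<close> formed by the first K digits is uniform on {0, ..., b^K -
  1}, because each value corresponds to exactly one digit string. It determines \<open>X\<close> up
  to b^-K, so the distribution function of \<open>X\<close> agrees with that of the uniform law up
  to an error that vanishes with K.\<close>

lemma (in prob_space) distr_uniform_digits:
  fixes D :: "nat \<Rightarrow> 'a \<Rightarrow> nat"
  assumes b: "2 \<le> b"
    and D_meas [measurable]: "\<And>k. D k \<in> M \<rightarrow>\<^sub>M count_space UNIV"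
    and D_less: "\<And>k \<omega>. D k \<omega> < b"
    and D_prob: "\<And>K d. (\<And>k. k < K \<Longrightarrow> d k < b) \<Longrightarrow>
      prob {\<omega>\<in>space M. \<forall>k<K. D k \<omega> = d k} = 1 / real b ^ K"
  shows "distr M borel (\<lambda>\<omega>. \<Sum>k. real (D k \<omega>) / real b ^ Suc k) = uniform_measure lborel {0<..<1}"
proof -
  define X where "X = (\<lambda>\<omega>. \<Sum>k. real (D k \<omega>) / real b ^ Suc k)"
  define N where "N = (\<lambda>K \<omega>. \<Sum>k<K. D k \<omega> * b ^ (K - Suc k))"
  have X_meas [measurable]: "X \<in> borel_measurable M" unfolding X_def by measurable
  have N_meas [measurable]: "N K \<in> M \<rightarrow>\<^sub>M count_space UNIV" for K unfolding N_def by measurable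
  have lower: "real (N K \<omega>) \<le> X \<omega> * real b ^ K" and upper: "X \<omega> * real b ^ K \<le> real (N K \<omega>) + 1" for K \<omega>
    unfolding N_def X_def using digit_expansion_bounds[OF b D_less] by auto
  have N_eq: "prob {\<omega>\<in>space M. N K \<omega> = v} = 1 / real b ^ K" if "v < b ^ K" for v K
  proof -
    have "{\<omega>\<in>space M. N K \<omega> = v} = {\<omega>\<in>space M. \<forall>k<K. D k \<omega> = v div b ^ (K - Suc k) mod b}"
      unfolding N_def using digit_expansion_eq_iff[OF D_less that] by auto
    then show ?thesis using b by (simp add: D_prob)
  qed
  have N_less: "prob {\<omega>\<in>space M. N K \<omega> < m} = real m / real b ^ K" if "m \<le> b ^ K" for m K
  proof -
    have "prob {\<omega>\<in>space M. N K \<omega> < m} = prob (\<Union>v<m. {\<omega>\<in>space M. N K \<omega> = v})"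
      by (intro arg_cong[where f=prob]) auto
    also have "\<dots> = (\<Sum>v<m. prob {\<omega>\<in>space M. N K \<omega> = v})"
      by (intro finite_measure_finite_Union) (auto simp: disjoint_family_on_def)
    also have "\<dots> = real m / real b ^ K" using that by (simp add: N_eq)
    finally show ?thesis .
  qed
  have X01: "0 \<le> X \<omega>" "X \<omega> \<le> 1" for \<omega>
    using lower[of 0 \<omega>] upper[of \<omega> 0] by (auto simp: N_def)
  have mid: "prob {\<omega>\<in>space M. X \<omega> \<le> t} = t" if t: "0 \<le> t" "t < 1" for t
  proof -
    have "\<bar>prob {\<omega>\<in>space M. X \<omega> \<le> t} - t\<bar> \<le> (1 / real b) ^ K" for K
    proof -
      \<comment> \<open>The events satisfy {N K < m} \<subseteq> {X \<le> t} \<subseteq> {N K < m +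
        1}. Hence both t and the probability of the middle event lie in an interval of length b^-K
        starting at m / b^K.\<close>
      define m where "m = nat \<lfloor>t * real b ^ K\<rfloor>"
      have bK: "0 < real b ^ K" using b by simp
      have m: "real m \<le> t * real b ^ K" "t * real b ^ K < real m + 1"
        unfolding m_def using t by (simp_all add: of_nat_nat)
      have "t * real b ^ K < real b ^ K" using t bK by simp
      then have "real m < real (b ^ K)" unfolding of_nat_power using m by linarith
      \<comment> \<open>Strictness, which comes from t < 1, allows \<open>N_less\<close> to be
        applied to \<open>Suc m\<close> as well.\<close>
      then have mb: "m < b ^ K" by (metis of_nat_less_iff)
      have "prob {\<omega>\<in>space M. N K \<omega> < m} \<le> prob {\<omega>\<in>space M. X \<omega> \<le> t}"
      proof (intro finite_measure_mono subsetI CollectI conjI; clarsimp)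
        fix \<omega> assume "N K \<omega> < m"
        then have "real (N K \<omega>) + 1 \<le> real m" by linarith
        then have "X \<omega> * real b ^ K \<le> t * real b ^ K"
          using upper[of \<omega> K] m(1) by linarith
        then show "X \<omega> \<le> t" using bK by simp
      qed
      moreover have "prob {\<omega>\<in>space M. X \<omega> \<le> t} \<le> prob {\<omega>\<in>space M. N K \<omega> < Suc m}"
      proof (intro finite_measure_mono subsetI CollectI conjI; clarsimp)
        fix \<omega> assume "X \<omega> \<le> t"
        then have "X \<omega> * real b ^ K \<le> t * real b ^ K" using bK by simp
        then have "real (N K \<omega>) < real (Suc m)" using m(2) lower[of K \<omega>] by simp
        then show "N K \<omega> < Suc m" by (simp only: of_nat_less_iff)
      qed
      ultimately have "real m / real b ^ K \<le> prob {\<omega>\<in>space M. X \<omega> \<le> t}"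
        "prob {\<omega>\<in>space M. X \<omega> \<le> t} \<le> (real m + 1) / real b ^ K"
        using mb by (simp_all add: N_less add.commute)
      moreover have "real m / real b ^ K \<le> t" "t \<le> (real m + 1) / real b ^ K"
        using m bK by (simp_all add: field_simps)
      ultimately show ?thesis by (simp add: abs_le_iff power_divide add_divide_distrib)
    qed
    moreover have "(\<lambda>K. (1 / real b) ^ K) \<longlonglongrightarrow> 0"
      using b by (intro LIMSEQ_realpow_zero) auto
    ultimately have "\<bar>prob {\<omega>\<in>space M. X \<omega> \<le> t} - t\<bar> \<le> 0"
      by (intro LIMSEQ_le_const) auto
    then show ?thesis by simp
  qed
  interpret U: prob_space "uniform_measure lborel {0<..<1::real}"
    by (intro prob_space_uniform_measure) auto
  have "distr M borel X = uniform_measure lborel {0<..<1}"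
  proof (rule cdf_unique, goal_cases)
    case 1 show ?case by (intro real_distribution_distr) simp
  next
    case 2 show ?case by unfold_locales simp_all
  next
    case 3
    have "cdf (distr M borel X) t = cdf (uniform_measure lborel {0<..<1}) t" for t
    proof -
      have L: "cdf (distr M borel X) t = prob {\<omega>\<in>space M. X \<omega> \<le> t}"
        unfolding cdf_def by (simp add: measure_distr vimage_def Int_def conj_commute)
      have R: "cdf (uniform_measure lborel {0<..<1}) t = measure lborel ({0<..<1} \<inter> {..t})"
        unfolding cdf_def by (subst measure_uniform_measure) auto
      consider "t < 0" | "0 \<le> t" "t < 1" | "1 \<le> t" by linarith
      then show ?thesis
      proof cases
        case 1
        then have *: "{\<omega>\<in>space M. X \<omega> \<le> t} = {}" "{0<..<1} \<inter> {..t} = {}"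
          using X01(1) by (auto simp: not_le intro: less_le_trans)
        show ?thesis unfolding L R * by simp
      next
        case 2
        then have "{0<..<1} \<inter> {..t} = {0<..t}" by auto
        then show ?thesis unfolding L R using 2 by (simp add: mid)
      next
        case 3
        then have *: "{\<omega>\<in>space M. X \<omega> \<le> t} = space M" "{0<..<1} \<inter> {..t} = {0<..<1}"
          using X01(2) by (auto intro: order_trans)
        show ?thesis unfolding L R * by (simp add: prob_space)
      qed
    qed
    then show ?case by (simp add: fun_eq_iff)
  qed
  then show ?thesis unfolding X_def .
qed

text \<open>The product spaces carry all functions, including non-permutations and values beyond b,
  so digit bounds may hold only almost surely. Reducing the digits mod b makes the bound hold
  everywhere and changes them on a null set only.\<close>

lemma (in prob_space) distr_AE_uniform_digits:
  fixes D :: "nat \<Rightarrow> 'a \<Rightarrow> nat"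
  assumes b: "2 \<le> b"
    and D_meas [measurable]: "\<And>k. D k \<in> M \<rightarrow>\<^sub>M count_space UNIV"
    and D_less: "\<And>k. AE \<omega> in M. D k \<omega> < b"
    and D_prob: "\<And>K d. (\<And>k. k < K \<Longrightarrow> d k < b) \<Longrightarrow>
      prob {\<omega>\<in>space M. \<forall>k<K. D k \<omega> = d k} = 1 / real b ^ K"
  shows "distr M borel (\<lambda>\<omega>. \<Sum>k. real (D k \<omega>) / real b ^ Suc k) = uniform_measure lborel {0<..<1}"
proof -
  have less: "AE \<omega> in M. \<forall>k. D k \<omega> < b"
    using D_less by (simp add: AE_all_countable)
  have "distr M borel (\<lambda>\<omega>. \<Sum>k. real (D k \<omega>) / real b ^ Suc k)
      = distr M borel (\<lambda>\<omega>. \<Sum>k. real (D k \<omega> mod b) / real b ^ Suc k)"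
    by (rule distr_cong_AE) (use less in auto)
  also have "\<dots> = uniform_measure lborel {0<..<1}"
  proof (rule distr_uniform_digits[OF b])
    fix K :: nat and d :: "nat \<Rightarrow> nat" assume d: "\<And>k. k < K \<Longrightarrow> d k < b"
    have "prob {\<omega>\<in>space M. \<forall>k<K. D k \<omega> mod b = d k} = prob {\<omega>\<in>space M. \<forall>k<K. D k \<omega> = d k}"
      by (rule finite_measure_eq_AE) (use less in auto)
    then show "prob {\<omega>\<in>space M. \<forall>k<K. D k \<omega> mod b = d k} = 1 / real b ^ K"
      using D_prob[OF d] by simp
  qed (use b in auto)
  finally show ?thesis .
qed

section \<open>Vectors with independent uniform coordinates\<close>

lemma borel_measurable_vecI:
  fixes g :: "'a \<Rightarrow> real ^ 'd"
  assumes "\<And>k. (\<lambda>x. g x $ k) \<in> borel_measurable M"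
  shows "g \<in> borel_measurable M"
  using assms by (subst borel_measurable_euclidean_space) (auto simp: Basis_vec_def inner_axis)

lemma borel_measurable_vec_nth [measurable]: "(\<lambda>x :: real ^ 'd. x $ k) \<in> borel_measurable borel"
  by (intro borel_measurable_continuous_onI continuous_intros)

text \<open>Empty boxes are included on purpose: intersecting an arbitrary box with the unit box may
  give lower corners above upper ones.\<close>

lemma emeasure_lborel_box_cart:
  fixes l u :: "real ^ 'd"
  shows "emeasure lborel (box l u) = (\<Prod>k\<in>UNIV. emeasure lborel {l $ k <..< u $ k})"
proof (cases "\<forall>k. l $ k \<le> u $ k")
  case True
  have "emeasure lborel (box l u) = ennreal (\<Prod>b\<in>Basis. (u - l) \<bullet> b)"
    using True by (subst emeasure_lborel_box) (auto simp: Basis_vec_def inner_axis)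
  also have "(\<Prod>b\<in>Basis. (u - l) \<bullet> b) = (\<Prod>k\<in>UNIV. u $ k - l $ k)"
    by (simp add: Basis_vec_def cart_eq_inner_axis axis_eq_axis prod.UNION_disjoint inner_diff_left)
  finally show ?thesis using True by (simp add: prod_ennreal)
next
  case False
  then obtain k where k: "u $ k < l $ k" by (auto simp: not_le)
  then have "box l u = {}" by (auto simp: set_eq_iff mem_box_cart intro!: exI[of _ k])
  moreover have "{l $ k <..< u $ k} = {}" using k by auto
  ultimately show ?thesis by (auto simp: prod_zero_iff intro!: exI[of _ k])
qed

text \<open>Open boxes form an intersection-stable generator of the Borel sets, and on a box
  independence factorizes the probability into one-dimensional interval lengths.\<close>

lemma (in prob_space) distr_indep_uniform_vector:
  fixes X :: "'a \<Rightarrow> real ^ 'd"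
  assumes ind: "indep_vars (\<lambda>_. borel) (\<lambda>k \<omega>. X \<omega> $ k) UNIV"
    and unif: "\<And>k. distr M borel (\<lambda>\<omega>. X \<omega> $ k) = uniform_measure lborel {0<..<1}"
  shows "distr M borel X = uniform_measure lborel (box 0 1)"
proof -
  have [measurable]: "(\<lambda>\<omega>. X \<omega> $ k) \<in> borel_measurable M" for k
    using ind by (auto simp: indep_vars_def2)
  have [measurable]: "X \<in> borel_measurable M"
    by (rule borel_measurable_vecI) simp
  show ?thesis
  proof (rule measure_eqI_generator_eq[where E="range (\<lambda>(l, u). box l u)" and \<Omega>=UNIV
      and A="\<lambda>n. box (- (real n *\<^sub>R One)) (real n *\<^sub>R One)"])
    fix B :: "(real ^ 'd) set" assume "B \<in> range (\<lambda>(l, u). box l u)"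
    then obtain l u where B: "B = box l u" by auto
    have "emeasure (distr M borel X) B = emeasure M {\<omega>\<in>space M. \<forall>k\<in>UNIV. X \<omega> $ k \<in> {l $ k <..< u $ k}}"
      unfolding B by (subst emeasure_distr) (auto simp: mem_box_cart intro!: arg_cong[where f="emeasure M"])
    also have "{\<omega>\<in>space M. \<forall>k\<in>UNIV. X \<omega> $ k \<in> {l $ k <..< u $ k}}
        = (\<Inter>k\<in>UNIV. (\<lambda>\<omega>. X \<omega> $ k) -` {l $ k <..< u $ k} \<inter> space M)" by auto
    also have "emeasure M \<dots> = ennreal (\<Prod>k\<in>UNIV. prob ((\<lambda>\<omega>. X \<omega> $ k) -` {l $ k <..< u $ k} \<inter> space M))"
      unfolding emeasure_eq_measure by (subst indep_varsD_finite[OF ind]) auto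
    also have "\<dots> = (\<Prod>k\<in>UNIV. emeasure (distr M borel (\<lambda>\<omega>. X \<omega> $ k)) {l $ k <..< u $ k})"
      by (simp add: prod_ennreal emeasure_distr emeasure_eq_measure)
    \<comment> \<open>The max and min express the intersection of each side with {0<..<1}; all sides
      together form the intersection with the unit box.\<close>
    also have "\<dots> = (\<Prod>k\<in>UNIV. emeasure lborel {max 0 (l $ k) <..< min 1 (u $ k)})"
      unfolding unif by (intro prod.cong refl) (simp add: Int_greaterThanLessThan divide_ennreal_def)
    also have "\<dots> = emeasure lborel (box (\<chi> k. max 0 (l $ k)) (\<chi> k. min 1 (u $ k)) :: (real ^ 'd) set)"
      by (simp add: emeasure_lborel_box_cart)
    also have "box (\<chi> k. max 0 (l $ k)) (\<chi> k. min 1 (u $ k)) = box 0 1 \<inter> B"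
      unfolding B by (auto simp: mem_box_cart)
    also have "emeasure lborel (box 0 1 \<inter> B) = emeasure (uniform_measure lborel (box 0 1)) B"
      by (subst emeasure_uniform_measure) (auto simp: B emeasure_lborel_box_cart divide_ennreal_def)
    finally show "emeasure (distr M borel X) B = emeasure (uniform_measure lborel (box 0 1)) B" .
  next
    show "Int_stable (range (\<lambda>(l, u). box l u :: (real ^ 'd) set))"
      by (auto simp: Int_stable_def box_Int_box)
    show "(\<Union>n. box (- (real n *\<^sub>R One)) (real n *\<^sub>R One)) = (UNIV :: (real ^ 'd) set)"
      by (rule UN_box_eq_UNIV)
    show "emeasure (distr M borel X) (box (- (real n *\<^sub>R One)) (real n *\<^sub>R One)) \<noteq> \<infinity>" for n
      by (simp add: emeasure_distr emeasure_eq_measure)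
  qed (auto simp: borel_eq_box)
qed

section \<open>Averaging over an independent coordinate\<close>

text \<open>Independence makes the joint law a product, so \<open>G\<close> at t is the mean of
  F(.,t) under the law of \<open>S\<close>. Both sides have the same mean \<open>m\<close>; for
  fixed t the square of the mean of F(.,t) - m is at most the mean of its square, and Fubini
  integrates this over t.\<close>

lemma (in prob_space) Var_cond_le:
  assumes ind: "indep_var N1 S N2 T"
    and F [measurable]: "F \<in> borel_measurable (N1 \<Otimes>\<^sub>M N2)"
    and F2: "integrable M (\<lambda>\<omega>. (F (S \<omega>, T \<omega>))\<^sup>2)"
    and G [measurable]: "G \<in> borel_measurable N2"
    and GF: "AE \<omega> in M. G (T \<omega>) = (\<integral>\<omega>'. F (S \<omega>', T \<omega>) \<partial>M)"
  shows "Var M (\<lambda>\<omega>. G (T \<omega>)) \<le> Var M (\<lambda>\<omega>. F (S \<omega>, T \<omega>))"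
proof -
  have [measurable]: "S \<in> M \<rightarrow>\<^sub>M N1" "T \<in> M \<rightarrow>\<^sub>M N2"
    and eq: "distr M N1 S \<Otimes>\<^sub>M distr M N2 T = distr M (N1 \<Otimes>\<^sub>M N2) (\<lambda>\<omega>. (S \<omega>, T \<omega>))"
    using ind unfolding indep_var_distribution_eq by auto
  interpret P: prob_space "distr M N1 S" by (rule prob_space_distr) simp
  interpret Q: prob_space "distr M N2 T" by (rule prob_space_distr) simp
  interpret PQ: pair_prob_space "distr M N1 S" "distr M N2 T" ..
  interpret J: prob_space "distr M (N1 \<Otimes>\<^sub>M N2) (\<lambda>\<omega>. (S \<omega>, T \<omega>))" by (rule prob_space_distr) simp
  define m where "m = (\<integral>\<omega>. F (S \<omega>, T \<omega>) \<partial>M)"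
  have [simp]: "sets (distr M N1 S \<Otimes>\<^sub>M distr M N2 T) = sets (N1 \<Otimes>\<^sub>M N2)"
    unfolding eq by simp
  have i2: "integrable (distr M N1 S \<Otimes>\<^sub>M distr M N2 T) (\<lambda>z. (F z)\<^sup>2)"
    unfolding eq by (rule integrable_distr_eq[THEN iffD2]) (use F2 in measurable)
  have i1: "integrable (distr M N1 S \<Otimes>\<^sub>M distr M N2 T) F"
    unfolding eq by (rule J.square_integrable_imp_integrable[OF _ i2[unfolded eq]]) simp
  have i3: "integrable (distr M N1 S \<Otimes>\<^sub>M distr M N2 T) (\<lambda>z. (F z - m)\<^sup>2)"
    using i1 i2 by (simp add: power2_diff)
  have m: "m = (\<integral>t. (\<integral>s. F (s, t) \<partial>distr M N1 S) \<partial>distr M N2 T)"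
  proof -
    have "(\<integral>t. (\<integral>s. F (s, t) \<partial>distr M N1 S) \<partial>distr M N2 T) = (\<integral>z. F z \<partial>(distr M N1 S \<Otimes>\<^sub>M distr M N2 T))"
      using PQ.integral_snd[of "\<lambda>s t. F (s, t)"] i1 by (simp add: split_beta')
    also have "\<dots> = m" unfolding eq m_def by (rule integral_distr) simp_all
    finally show ?thesis by simp
  qed
  have GF': "AE t in distr M N2 T. G t = (\<integral>s. F (s, t) \<partial>distr M N1 S)"
  proof (subst AE_distr_iff)
    show "AE \<omega> in M. G (T \<omega>) = (\<integral>s. F (s, T \<omega>) \<partial>distr M N1 S)"
      using GF AE_space
    proof eventually_elim
      case (elim \<omega>)
      then have [simp]: "T \<omega> \<in> space N2" by (meson \<open>T \<in> M \<rightarrow>\<^sub>M N2\<close> measurable_space)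
      show ?case using elim by (subst integral_distr) auto
    qed
  qed auto
  have Gm: "(\<integral>\<omega>. G (T \<omega>) \<partial>M) = m"
  proof -
    have "(\<integral>\<omega>. G (T \<omega>) \<partial>M) = (\<integral>t. G t \<partial>distr M N2 T)" by (subst integral_distr) simp_all
    also have "\<dots> = m" unfolding m using GF' by (intro integral_cong_AE) auto
    finally show ?thesis .
  qed
  have "Var M (\<lambda>\<omega>. G (T \<omega>)) = (\<integral>t. (G t - m)\<^sup>2 \<partial>distr M N2 T)"
    unfolding Var_def Gm by (subst integral_distr) simp_all
  also have "\<dots> \<le> (\<integral>t. (\<integral>s. (F (s, t) - m)\<^sup>2 \<partial>distr M N1 S) \<partial>distr M N2 T)"
  proof -
    have "AE t in distr M N2 T. integrable (distr M N1 S) (\<lambda>s. F (s, t))"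
      using i1 by (intro PQ.AE_integrable_snd) (simp add: split_beta')
    moreover have "AE t in distr M N2 T. integrable (distr M N1 S) (\<lambda>s. (F (s, t) - m)\<^sup>2)"
      using i3 by (intro PQ.AE_integrable_snd) (simp add: split_beta')
    ultimately have "AE t in distr M N2 T. (G t - m)\<^sup>2 \<le> (\<integral>s. (F (s, t) - m)\<^sup>2 \<partial>distr M N1 S)"
      using GF'
    proof eventually_elim
      case (elim t)
      have I: "integrable (distr M N1 S) (\<lambda>s. F (s, t) - m)" using elim(1) by simp
      have "(\<integral>s. F (s, t) - m \<partial>distr M N1 S)\<^sup>2 \<le> (\<integral>s. (F (s, t) - m)\<^sup>2 \<partial>distr M N1 S)"
        \<comment> \<open>This is nonnegativity of the variance of F(.,t) - m under the law of
          \<open>S\<close>.\<close>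
        using P.variance_eq[OF I elim(2)] P.variance_positive[of "\<lambda>s. F (s, t) - m"] by linarith
      moreover have "(\<integral>s. F (s, t) - m \<partial>distr M N1 S) = G t - m"
        using elim(1,3) by (simp add: P.prob_space[simplified])
      ultimately show ?case by simp
    qed
    moreover have "integrable (distr M N2 T) (\<lambda>t. \<integral>s. (F (s, t) - m)\<^sup>2 \<partial>distr M N1 S)"
      using PQ.integrable_snd[of "\<lambda>s t. (F (s, t) - m)\<^sup>2"] i3 by (simp add: split_beta')
    \<comment> \<open>Integrability is known for the larger integrand only; as it is nonnegative,
      that is enough for the comparison.\<close>
    ultimately show ?thesis
      by (intro integral_mono_AE') auto
  qed
  also have "\<dots> = (\<integral>z. (F z - m)\<^sup>2 \<partial>(distr M N1 S \<Otimes>\<^sub>M distr M N2 T))"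
    using PQ.integral_snd[of "\<lambda>s t. (F (s, t) - m)\<^sup>2"] i3 by (simp add: split_beta')
  also have "\<dots> = Var M (\<lambda>\<omega>. F (S \<omega>, T \<omega>))"
    unfolding eq Var_def m_def by (subst integral_distr) simp_all
  finally show ?thesis .
qed

lemma uniform_measure_real_density:
  assumes "emeasure M A = 1"
  shows "uniform_measure M A = density M (\<lambda>x. ennreal (indicator A x))"
  using assms by (simp add: uniform_measure_def divide_ennreal_def ennreal_indicator)

lemma borel_measurable_avg_coord [measurable]:
  fixes f :: "real ^ 'd \<Rightarrow> real"
  assumes [measurable]: "f \<in> borel_measurable borel"
  shows "avg_coord f j \<in> borel_measurable borel"
proof -
  have [measurable]: "(\<lambda>(x :: real ^ 'd, y :: real). \<chi> k. if k = j then y else x $ k) \<in> borel_measurable (borel \<Otimes>\<^sub>M lborel)"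
    unfolding split_beta' by (rule borel_measurable_vecI) auto
  have "(\<lambda>(x, y). f (\<chi> k. if k = j then y else x $ k)) \<in> borel_measurable (borel \<Otimes>\<^sub>M lborel)"
    by measurable
  then show ?thesis
    unfolding avg_coord_def[abs_def] set_lebesgue_integral_def
    by (intro lborel.borel_measurable_lebesgue_integral) (auto simp: split_beta')
qed

text \<open>The closed interval in \<open>avg_coord\<close> and the open one carrying the law of a
  scrambled coordinate differ by the null set {0, 1}.\<close>

lemma avg_coord_eq_uniform:
  fixes f :: "real ^ 'd \<Rightarrow> real"
  assumes [measurable]: "f \<in> borel_measurable borel"
  shows "avg_coord f j x = (\<integral>y. f (\<chi> k. if k = j then y else x $ k) \<partial>uniform_measure lborel {0<..<1})"
proof -
  have [measurable]: "(\<lambda>y. \<chi> k. if k = j then y else x $ k) \<in> borel_measurable borel"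
    by (rule borel_measurable_vecI) auto
  have "avg_coord f j x = (LINT y:{0<..<1}|lborel. f (\<chi> k. if k = j then y else x $ k))"
    unfolding avg_coord_def set_lebesgue_integral_def
    using AE_lborel_singleton[of 0] AE_lborel_singleton[of 1]
    by (intro integral_cong_AE) (auto elim!: eventually_elim2 split: split_indicator)
  also have "\<dots> = (\<integral>y. f (\<chi> k. if k = j then y else x $ k) \<partial>uniform_measure lborel {0<..<1})"
    unfolding set_lebesgue_integral_def
    by (subst uniform_measure_real_density; (subst integral_density)?) auto
  finally show ?thesis .
qed

text \<open>Independence is required between coordinates, each taken with all n points at once;
  within a coordinate the points may depend on each other arbitrarily. \<open>Var_cond_le\<close>
  applies with \<open>S\<close> the tuple of coordinate \<open>j\<close> and \<open>T\<close> the
  tuples of all others.\<close>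

lemma (in prob_space) Var_avg_coord_le:
  fixes X :: "nat \<Rightarrow> 'a \<Rightarrow> real ^ 'd" and f :: "real ^ 'd \<Rightarrow> real"
  assumes ind: "indep_vars (\<lambda>_. PiM {..<n} (\<lambda>_. borel)) (\<lambda>k \<omega>. \<lambda>i\<in>{..<n}. X i \<omega> $ k) UNIV"
    and unif: "\<And>i k. i < n \<Longrightarrow> distr M borel (\<lambda>\<omega>. X i \<omega> $ k) = uniform_measure lborel {0<..<1}"
    and f [measurable]: "f \<in> borel_measurable borel"
    and f2: "set_integrable lborel unit_cube (\<lambda>x. (f x)\<^sup>2)"
  shows "Var M (\<lambda>\<omega>. (\<Sum>i<n. avg_coord f j (X i \<omega>)) / real n)
           \<le> Var M (\<lambda>\<omega>. (\<Sum>i<n. f (X i \<omega>)) / real n)"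
proof -
  define N where "N = PiM {..<n} (\<lambda>_::nat. borel :: real measure)"
  define N0 where "N0 = PiM {j} (\<lambda>_. N)"
  define N' where "N' = PiM (- {j}) (\<lambda>_. N)"
  define S where "S = (\<lambda>\<omega>. \<lambda>k\<in>{j}. \<lambda>i\<in>{..<n}. X i \<omega> $ k)"
  define T where "T = (\<lambda>\<omega>. \<lambda>k\<in>-{j}. \<lambda>i\<in>{..<n}. X i \<omega> $ k)"
  \<comment> \<open>\<open>put\<close> reassembles point i from the two independent parts.\<close>
  define put where "put = (\<lambda>i (s :: 'd \<Rightarrow> nat \<Rightarrow> real, t :: 'd \<Rightarrow> nat \<Rightarrow> real). (\<chi> k. if k = j then s j i else t k i) :: real ^ 'd)"
  define F where "F = (\<lambda>z. (\<Sum>i<n. f (put i z)) / real n)"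
  \<comment> \<open>The constant 0 is a dummy for coordinate \<open>j\<close>, which
    \<open>avg_coord\<close> overwrites; this makes the average a function of \<open>T\<close>
    alone.\<close>
  define G where "G = (\<lambda>t. (\<Sum>i<n. avg_coord f j (put i ((\<lambda>_ _. 0), t))) / real n)"
  have S_comp: "(\<lambda>s. s j i) \<in> borel_measurable N0" if "i < n" for i
  proof -
    have "(\<lambda>s. s j) \<in> N0 \<rightarrow>\<^sub>M N" unfolding N0_def by (intro measurable_component_singleton) simp
    moreover have "(\<lambda>s. s i) \<in> borel_measurable N" unfolding N_def using that by (intro measurable_component_singleton) simp
    ultimately show ?thesis by (rule measurable_compose)
  qed
  have T_comp: "(\<lambda>t. t k i) \<in> borel_measurable N'" if "k \<noteq> j" "i < n" for k i
  proof -
    have "(\<lambda>t. t k) \<in> N' \<rightarrow>\<^sub>M N" unfolding N'_def using that by (intro measurable_component_singleton) simp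
    moreover have "(\<lambda>s. s i) \<in> borel_measurable N" unfolding N_def using that by (intro measurable_component_singleton) simp
    ultimately show ?thesis by (rule measurable_compose)
  qed
  have put_meas [measurable]: "put i \<in> borel_measurable (N0 \<Otimes>\<^sub>M N')" if "i < n" for i
  proof (rule borel_measurable_vecI)
    fix k
    have "(\<lambda>z. fst z j i) \<in> borel_measurable (N0 \<Otimes>\<^sub>M N')"
      using measurable_compose[OF measurable_fst S_comp] that .
    then show "(\<lambda>z. put i z $ k) \<in> borel_measurable (N0 \<Otimes>\<^sub>M N')"
      using measurable_compose[OF measurable_snd T_comp[of k i], of N0] that
      by (cases "k = j") (simp_all add: put_def split_beta')
  qed
  have put0_meas [measurable]: "(\<lambda>t. put i ((\<lambda>_ _. 0), t)) \<in> borel_measurable N'" if "i < n" for i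
  proof (rule borel_measurable_vecI)
    fix k show "(\<lambda>t. put i ((\<lambda>_ _. 0), t) $ k) \<in> borel_measurable N'"
      using T_comp[of k i] that by (cases "k = j") (simp_all add: put_def)
  qed
  have F_meas: "F \<in> borel_measurable (N0 \<Otimes>\<^sub>M N')" unfolding F_def by measurable
  have G_meas: "G \<in> borel_measurable N'" unfolding G_def by measurable
  have put_ST: "put i (S \<omega>, T \<omega>) = X i \<omega>" if "i < n" for i \<omega>
    using that by (simp add: put_def S_def T_def vec_eq_iff)
  have avg_T: "avg_coord f j (put i ((\<lambda>_ _. 0), T \<omega>)) = avg_coord f j (X i \<omega>)" if "i < n" for i \<omega>
    using that unfolding avg_coord_def put_def T_def by (auto intro!: arg_cong[where f="\<lambda>g. set_lebesgue_integral _ _ g"] arg_cong[where f=f] simp: vec_eq_iff fun_eq_iff)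
  have indST: "indep_var N0 S N' T"
    unfolding N0_def N'_def S_def T_def N_def by (rule indep_var_restrict[OF ind]) auto
  have S_meas [measurable]: "S \<in> M \<rightarrow>\<^sub>M N0" and T_meas [measurable]: "T \<in> M \<rightarrow>\<^sub>M N'"
    and eq: "distr M N0 S \<Otimes>\<^sub>M distr M N' T = distr M (N0 \<Otimes>\<^sub>M N') (\<lambda>\<omega>. (S \<omega>, T \<omega>))"
    using indST unfolding indep_var_distribution_eq by auto
  have coord_meas: "random_variable borel (\<lambda>\<omega>. X i \<omega> $ k)" if "i < n" for i k
  proof -
    have "random_variable (PiM {..<n} (\<lambda>_. borel)) (\<lambda>\<omega>. \<lambda>i\<in>{..<n}. X i \<omega> $ k)"
      using ind by (auto simp: indep_vars_def2)
    from measurable_compose[OF this measurable_component_singleton[of i]] that show ?thesis by simp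
  qed
  have X_meas [measurable]: "X i \<in> borel_measurable M" if "i < n" for i
    by (rule borel_measurable_vecI) (rule coord_meas[OF that])
  have distr_X: "distr M borel (X i) = uniform_measure lborel (box 0 1)" if "i < n" for i
  proof (rule distr_indep_uniform_vector)
    have "indep_vars (\<lambda>_. borel) (\<lambda>k \<omega>. (\<lambda>s. s i) (\<lambda>i\<in>{..<n}. X i \<omega> $ k)) UNIV"
      by (rule indep_vars_compose2[OF ind]) (use that in auto)
    then show "indep_vars (\<lambda>_. borel) (\<lambda>k \<omega>. X i \<omega> $ k) UNIV" using that by simp
  qed (rule unif[OF that])
  have box1: "emeasure lborel (box 0 1 :: (real ^ 'd) set) = 1"
    by (simp add: emeasure_lborel_box_cart)
  have int2: "integrable M (\<lambda>\<omega>. (f (X i \<omega>))\<^sup>2)" if "i < n" for i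
  proof -
    \<comment> \<open>Square integrability is given on \<open>unit_cube\<close> only; the law of a
      point is concentrated on the open box inside it.\<close>
    have "set_integrable lborel (box 0 1) (\<lambda>x. (f x)\<^sup>2)"
      by (rule set_integrable_subset[OF f2]) (auto simp: unit_cube_def mem_box_cart less_imp_le)
    then have "integrable (distr M borel (X i)) (\<lambda>x. (f x)\<^sup>2)"
      unfolding distr_X[OF that] uniform_measure_real_density[OF box1] set_integrable_def
      by (subst integrable_density) auto
    then show ?thesis using that by (subst (asm) integrable_distr_eq) auto
  qed
  have F_ST: "F (S \<omega>, T \<omega>) = (\<Sum>i<n. f (X i \<omega>)) / real n" for \<omega>
    unfolding F_def by (simp add: put_ST)
  have G_T: "G (T \<omega>) = (\<Sum>i<n. avg_coord f j (X i \<omega>)) / real n" for \<omega>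
    unfolding G_def by (simp add: avg_T)
  have F2: "integrable M (\<lambda>\<omega>. (F (S \<omega>, T \<omega>))\<^sup>2)"
  proof -
    \<comment> \<open>By Cauchy-Schwarz the squared sum is at most n times the sum of the
      squares.\<close>
    have *: "integrable M (\<lambda>\<omega>. (\<Sum>i<n. f (X i \<omega>))\<^sup>2)"
    proof (rule Bochner_Integration.integrable_bound)
      show "integrable M (\<lambda>\<omega>. (\<Sum>i<n. (f (X i \<omega>))\<^sup>2) * real (card {..<n}))"
        using int2 by (intro integrable_mult_left Bochner_Integration.integrable_sum) auto
      show "AE \<omega> in M. norm ((\<Sum>i<n. f (X i \<omega>))\<^sup>2) \<le> norm ((\<Sum>i<n. (f (X i \<omega>))\<^sup>2) * real (card {..<n}))"
        using sum_squared_le_sum_of_squares[of "\<lambda>i. f (X i _)" "{..<n}"]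
        by (auto simp: abs_mult sum_nonneg)
    qed measurable
    show ?thesis unfolding F_ST power_divide using * by simp
  qed
  have GF: "AE \<omega> in M. G (T \<omega>) = (\<integral>\<omega>'. F (S \<omega>', T \<omega>) \<partial>M)"
  proof -
    interpret P: prob_space "distr M N0 S" by (rule prob_space_distr) simp
    interpret Q: prob_space "distr M N' T" by (rule prob_space_distr) simp
    interpret PQ: pair_prob_space "distr M N0 S" "distr M N' T" ..
    \<comment> \<open>Exchanging the sum over points with the integral needs each summand to be
      integrable by itself; Fubini gives this for almost every value of \<open>T\<close>.\<close>
    have "AE \<omega> in M. integrable M (\<lambda>\<omega>'. f (put i (S \<omega>', T \<omega>)))" if i: "i < n" for i
    proof -
      have "integrable M (\<lambda>\<omega>. f (X i \<omega>))"
        by (rule square_integrable_imp_integrable[OF _ int2[OF i]]) (use i in measurable)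
      then have "integrable (distr M (N0 \<Otimes>\<^sub>M N') (\<lambda>\<omega>. (S \<omega>, T \<omega>))) (\<lambda>z. f (put i z))"
        by (intro integrable_distr_eq[THEN iffD2]) (use i in \<open>simp_all add: put_ST\<close>)
      then have "AE t in distr M N' T. integrable (distr M N0 S) (\<lambda>s. f (put i (s, t)))"
        unfolding eq[symmetric] by (intro PQ.AE_integrable_snd) (simp add: split_beta')
      then have "AE \<omega> in M. integrable (distr M N0 S) (\<lambda>s. f (put i (s, T \<omega>)))"
        by (rule AE_distrD[OF T_meas])
      then show ?thesis
        using AE_space
      proof eventually_elim
        case (elim \<omega>)
        then have [simp]: "T \<omega> \<in> space N'" by (meson T_meas measurable_space)
        show ?case
          by (rule integrable_distr_eq[THEN iffD1, OF S_meas _ elim(1)]) (use i in measurable)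
      qed
    qed
    then have "AE \<omega> in M. \<forall>i\<in>{..<n}. integrable M (\<lambda>\<omega>'. f (put i (S \<omega>', T \<omega>)))"
      by (intro AE_finite_allI) auto
    then show ?thesis
    proof eventually_elim
      case (elim \<omega>)
      \<comment> \<open>With \<open>T\<close> frozen, only coordinate \<open>j\<close> of point i is
        still random, and its law is uniform.\<close>
      have "(\<integral>\<omega>'. f (put i (S \<omega>', T \<omega>)) \<partial>M) = avg_coord f j (put i ((\<lambda>_ _. 0), T \<omega>))" if i: "i < n" for i
      proof -
        define h where "h = (\<lambda>y. f (\<chi> k. if k = j then y else put i ((\<lambda>_ _. 0), T \<omega>) $ k))"
        have "(\<lambda>y. \<chi> k. if k = j then y else put i ((\<lambda>_ _. 0), T \<omega>) $ k) \<in> borel_measurable borel"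
          by (rule borel_measurable_vecI) auto
        then have [measurable]: "h \<in> borel_measurable borel" unfolding h_def by measurable
        have "avg_coord f j (put i ((\<lambda>_ _. 0), T \<omega>)) = (\<integral>y. h y \<partial>distr M borel (\<lambda>\<omega>'. X i \<omega>' $ j))"
          unfolding unif[OF i] h_def by (rule avg_coord_eq_uniform[OF f])
        also have "\<dots> = (\<integral>\<omega>'. h (X i \<omega>' $ j) \<partial>M)"
          by (rule integral_distr) (use coord_meas[OF i] in measurable)
        also have "(\<lambda>\<omega>'. h (X i \<omega>' $ j)) = (\<lambda>\<omega>'. f (put i (S \<omega>', T \<omega>)))"
          using i by (auto simp: h_def put_def S_def fun_eq_iff vec_eq_iff intro!: arg_cong[where f=f])
        finally show ?thesis ..
      qed
      then show ?case
        unfolding F_def G_def using elim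
        by (subst integral_divide_zero, subst Bochner_Integration.integral_sum) auto
    qed
  qed
  show ?thesis
    using Var_cond_le[OF indST F_meas F2 G_meas GF] unfolding F_ST G_T .
qed

section \<open>Product measures with a separate block of indices for each coordinate\<close>

lemma indep_vars_PiM_components:
  assumes K: "\<And>t. t \<in> I \<Longrightarrow> prob_space (K t)" and I: "I \<noteq> {}"
  shows "prob_space.indep_vars (PiM I K) K (\<lambda>t \<omega>. \<omega> t) I"
proof -
  interpret prob_space "PiM I K" using K by (rule prob_space_PiM)
  have "distr (PiM I K) (PiM I K) (\<lambda>\<omega>. \<lambda>t\<in>I. \<omega> t) = distr (PiM I K) (PiM I K) (\<lambda>\<omega>. \<omega>)"
    by (rule distr_cong) (auto simp: space_PiM)
  also have "\<dots> = (\<Pi>\<^sub>M t\<in>I. distr (PiM I K) (K t) (\<lambda>\<omega>. \<omega> t))"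
    unfolding distr_id by (rule PiM_cong) (auto intro!: distr_PiM_component[OF K, symmetric])
  finally show ?thesis
    by (subst indep_vars_iff_distr_eq_PiM'[OF I]) auto
qed

text \<open>Common interface for both scrambles. \<open>c k\<close> is the block of random inputs
  available to coordinate k; since \<open>D i k r\<close> reads only this block and blocks are
  disjoint, coordinates are independent. The digits of one point in one coordinate need only have
  the right joint law. Index r stands for digit r + 1.\<close>

lemma Var_avg_coord_le_PiM:
  fixes K :: "'i \<Rightarrow> 'v measure" and c :: "'d :: finite \<Rightarrow> 'i set"
    and D :: "nat \<Rightarrow> 'd \<Rightarrow> nat \<Rightarrow> ('i \<Rightarrow> 'v) \<Rightarrow> nat" and f :: "real ^ 'd \<Rightarrow> real"
  assumes K: "\<And>t. t \<in> I \<Longrightarrow> prob_space (K t)" and I: "I \<noteq> {}"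
    and c: "\<And>k. c k \<subseteq> I" "disjoint_family c"
    and b: "2 \<le> b"
    and D_meas: "\<And>i k r. D i k r \<in> PiM (c k) K \<rightarrow>\<^sub>M count_space UNIV"
    and D_restrict: "\<And>i k r \<omega>. D i k r (restrict \<omega> (c k)) = D i k r \<omega>"
    and D_less: "\<And>i k r. AE \<omega> in PiM I K. D i k r \<omega> < b"
    and D_prob: "\<And>i k R d. (\<And>r. r < R \<Longrightarrow> d r < b) \<Longrightarrow>
      measure (PiM I K) {\<omega>\<in>space (PiM I K). \<forall>r<R. D i k r \<omega> = d r} = 1 / real b ^ R"
    and f: "f \<in> borel_measurable borel" "set_integrable lborel unit_cube (\<lambda>x. (f x)\<^sup>2)"
  defines "X \<equiv> \<lambda>i \<omega>. \<chi> k. \<Sum>r. real (D i k r \<omega>) / real b ^ Suc r"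
  shows "Var (PiM I K) (\<lambda>\<omega>. (\<Sum>i<n. avg_coord f j (X i \<omega>)) / real n)
           \<le> Var (PiM I K) (\<lambda>\<omega>. (\<Sum>i<n. f (X i \<omega>)) / real n)"
proof -
  interpret prob_space "PiM I K" using K by (rule prob_space_PiM)
  note [measurable] = D_meas
  have [measurable]: "D i k r \<in> PiM I K \<rightarrow>\<^sub>M count_space UNIV" for i k r
    using measurable_compose[OF measurable_restrict_subset[OF c(1)[of k]] D_meas[of i k r]]
    by (simp add: D_restrict)
  have "indep_vars (\<lambda>_. PiM {..<n} (\<lambda>_. borel))
      (\<lambda>k \<omega>. (\<lambda>\<omega>. \<lambda>i\<in>{..<n}. \<Sum>r. real (D i k r \<omega>) / real b ^ Suc r) (\<lambda>t\<in>c k. \<omega> t)) UNIV"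
    by (rule indep_vars_compose2[OF indep_vars_restrict[OF indep_vars_PiM_components[OF K I]]])
      (use c in measurable)
  then have "indep_vars (\<lambda>_. PiM {..<n} (\<lambda>_. borel)) (\<lambda>k \<omega>. \<lambda>i\<in>{..<n}. X i \<omega> $ k) UNIV"
    by (simp add: X_def D_restrict)
  moreover have "distr (PiM I K) borel (\<lambda>\<omega>. X i \<omega> $ k) = uniform_measure lborel {0<..<1}" for i k
    unfolding X_def vec_lambda_beta
    by (rule distr_AE_uniform_digits[OF b]) (use D_less D_prob in auto)
  ultimately show ?thesis by (rule Var_avg_coord_le) (use f in auto)
qed

section \<open>Nested uniform scrambling\<close>

text \<open>Composing with the transposition of u and z injects the permutations sending x to u into
  those sending x to z. So all fibres of p \<mapsto> p x have equal size, and they partition the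
  permutations.\<close>

lemma card_permutes_maps_to:
  assumes S: "finite S" and x: "x \<in> S" and y: "y \<in> S"
  shows "card S * card {p. p permutes S \<and> p x = y} = card {p. p permutes S}"
proof -
  define C where "C = (\<lambda>y. {p. p permutes S \<and> p x = y})"
  have fin: "finite (C y)" for y
    unfolding C_def by (rule finite_subset[OF _ finite_permutations[OF S]]) auto
  have le: "card (C u) \<le> card (C z)" if "u \<in> S" "z \<in> S" for u z
  proof (rule card_inj_on_le[OF _ _ fin])
    show "inj_on (\<lambda>p. Transposition.transpose u z \<circ> p) (C u)"
      by (rule inj_onI) (metis comp_assoc id_comp transpose_comp_involutory)
    show "(\<lambda>p. Transposition.transpose u z \<circ> p) ` C u \<subseteq> C z"
    proof
      fix q assume "q \<in> (\<lambda>p. Transposition.transpose u z \<circ> p) ` C u"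
      then obtain p where "p permutes S" "p x = u" "q = Transposition.transpose u z \<circ> p" unfolding C_def by blast
      then show "q \<in> C z"
        unfolding C_def using permutes_compose[OF _ permutes_swap_id[OF that]] by simp
    qed
  qed
  have "{p. p permutes S} = (\<Union>z\<in>S. C z)"
    unfolding C_def using x permutes_in_image[of _ S x] by blast
  then have "card {p. p permutes S} = card (\<Union>z\<in>S. C z)" by simp
  also have "\<dots> = (\<Sum>z\<in>S. card (C z))"
    by (rule card_UN_disjoint) (use S fin in \<open>auto simp: C_def\<close>)
  also have "\<dots> = (\<Sum>z\<in>S. card (C y))"
    using le y by (intro sum.cong refl antisym) simp_all
  finally show ?thesis by (simp add: C_def)
qed

lemma measure_uniform_permutation_maps_to:
  assumes "x < b" "y < b"
  shows "measure (pmf_of_set {p. p permutes {..<b}}) {p. p x = y} = 1 / real b"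
proof -
  have ne: "{p. p permutes {..<b}} \<noteq> {}" using permutes_id by blast
  have fin: "finite {p. p permutes {..<b}}" by (simp add: finite_permutations)
  have c0: "card {p. p permutes {..<b}} > 0" using ne fin by (simp add: card_gt_0_iff)
  have "{p. p permutes {..<b}} \<inter> {p. p x = y} = {p. p permutes {..<b} \<and> p x = y}" by auto
  moreover have "real b * real (card {p. p permutes {..<b} \<and> p x = y}) = real (card {p. p permutes {..<b}})"
    using card_permutes_maps_to[of "{..<b}" x y] assms by (simp flip: of_nat_mult)
  ultimately show ?thesis
    using ne fin c0 assms by (simp add: measure_pmf_of_set field_simps)
qed

text \<open>For one point, the permutations acting on successive digits are indexed by prefixes of
  different lengths. They are therefore different components of the product measure, and each sends
  its fixed input digit to a uniform output.\<close>

lemma Var_nested_scramble_le: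
  fixes a :: "nat \<Rightarrow> real ^ 'd" and f :: "real ^ 'd \<Rightarrow> real"
  assumes b: "2 \<le> b"
    and f: "f \<in> borel_measurable borel" "set_integrable lborel unit_cube (\<lambda>x. (f x)\<^sup>2)"
  shows "Var (nested_space b) (\<lambda>\<pi>. (\<Sum>i<n. avg_coord f j (nested_scramble b \<pi> (a i))) / real n)
           \<le> Var (nested_space b) (\<lambda>\<pi>. (\<Sum>i<n. f (nested_scramble b \<pi> (a i))) / real n)"
  unfolding nested_space_def nested_scramble_def
proof (rule Var_avg_coord_le_PiM[where c="\<lambda>k. {k} \<times> lists {..<b}", OF _ _ _ _ b _ _ _ _ f])
  let ?I = "UNIV \<times> lists {..<b} :: ('d \<times> nat list) set"
  let ?K = "\<lambda>_ :: 'd \<times> nat list. measure_pmf (pmf_of_set {p. p permutes {..<b}})"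
  define pre where "pre = (\<lambda>i (k::'d) r. (k, map (digit b (a i $ k)) [1..<Suc r]))"
  have dig: "digit b t r < b" for t r using b by (simp add: digit_def)
  have pre: "pre i k r \<in> {k} \<times> lists {..<b}" for i k r
    using dig by (auto simp: pre_def)
  have pre_eq: "(k, map (digit b (a i $ k)) [1..<Suc r]) = pre i k r" for i k r
    by (simp only: pre_def)
  have len: "length (snd (pre i k r)) = r" for i k r by (simp add: pre_def)
  have perms: "{p. p permutes {..<b}} \<noteq> {}" "finite {p. p permutes {..<b}}"
    using permutes_id by (blast, simp add: finite_permutations)
  interpret product_prob_space ?K ?I ..
  show "prob_space (?K t)" for t by (rule measure_pmf.prob_space_axioms)
  show "?I \<noteq> {}" by blast
  show "{k} \<times> lists {..<b} \<subseteq> ?I" for k by blast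
  show "disjoint_family (\<lambda>k :: 'd. {k} \<times> lists {..<b})" unfolding disjoint_family_on_def by blast
  fix i k
  show "(\<lambda>\<pi>. \<pi> (k, map (digit b (a i $ k)) [1..<Suc r]) (digit b (a i $ k) (Suc r)))
      \<in> PiM ({k} \<times> lists {..<b}) ?K \<rightarrow>\<^sub>M count_space UNIV" for r
    using pre[of i k r] unfolding pre_def
    by (intro measurable_compose[OF measurable_component_singleton]) auto
  show "restrict \<pi> ({k} \<times> lists {..<b}) (k, map (digit b (a i $ k)) [1..<Suc r]) (digit b (a i $ k) (Suc r))
      = \<pi> (k, map (digit b (a i $ k)) [1..<Suc r]) (digit b (a i $ k) (Suc r))"
    for r and \<pi> :: "'d \<times> nat list \<Rightarrow> nat \<Rightarrow> nat"
    using pre[of i k r] unfolding pre_def by (simp only: restrict_apply if_True)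
  show "AE \<pi> in PiM ?I ?K. \<pi> (k, map (digit b (a i $ k)) [1..<Suc r]) (digit b (a i $ k) (Suc r)) < b" for r
  proof (rule AE_component)
    show "(k, map (digit b (a i $ k)) [1..<Suc r]) \<in> ?I" using pre[of i k r] unfolding pre_def by auto
    show "AE p in pmf_of_set {p. p permutes {..<b}}. p (digit b (a i $ k) (Suc r)) < b"
      using perms dig by (auto simp: AE_measure_pmf_iff dest: permutes_in_image[where x="digit b (a i $ k) (Suc r)"])
  qed
  fix R and d :: "nat \<Rightarrow> nat" assume d: "\<And>r. r < R \<Longrightarrow> d r < b"
  \<comment> \<open>The events are indexed by prefixes, as the product measure is; the length of a
    prefix recovers the digit position.\<close>
  define Y where "Y = (\<lambda>t :: 'd \<times> nat list. {p :: nat \<Rightarrow> nat. p (digit b (a i $ k) (Suc (length (snd t)))) = d (length (snd t))})"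
  have inj: "inj_on (pre i k) {..<R}" using len by (metis inj_onI)
  have sub: "pre i k ` {..<R} \<subseteq> ?I" using pre by (auto simp: image_subset_iff mem_Times_iff)
  have "emeasure (PiM ?I ?K) {\<pi>\<in>space (PiM ?I ?K). \<forall>t\<in>pre i k ` {..<R}. \<pi> t \<in> Y t}
      = (\<Prod>t\<in>pre i k ` {..<R}. emeasure (pmf_of_set {p. p permutes {..<b}}) (Y t))"
    by (rule emeasure_PiM_Collect[OF sub]) auto
  then have "measure (PiM ?I ?K) {\<pi>\<in>space (PiM ?I ?K). \<forall>t\<in>pre i k ` {..<R}. \<pi> t \<in> Y t}
      = (\<Prod>t\<in>pre i k ` {..<R}. measure (pmf_of_set {p. p permutes {..<b}}) (Y t))"
    unfolding measure_pmf.emeasure_eq_measure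
    by (subst (asm) prod_ennreal) (auto simp: measure_def prod_nonneg)
  also have "\<dots> = 1 / real b ^ R"
    using d dig by (simp add: prod.reindex[OF inj] len Y_def measure_uniform_permutation_maps_to power_one_over)
  also have "{\<pi>\<in>space (PiM ?I ?K). \<forall>t\<in>pre i k ` {..<R}. \<pi> t \<in> Y t}
    = {\<pi>\<in>space (PiM ?I ?K). \<forall>r<R. \<pi> (k, map (digit b (a i $ k)) [1..<Suc r]) (digit b (a i $ k) (Suc r)) = d r}"
    unfolding Y_def pre_eq by (auto simp: len)
  finally show "measure (PiM ?I ?K) {\<pi>\<in>space (PiM ?I ?K). \<forall>r<R.
    \<pi> (k, map (digit b (a i $ k)) [1..<Suc r]) (digit b (a i $ k) (Suc r)) = d r} = 1 / real b ^ R" .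
qed

section \<open>Random linear scrambling\<close>

text \<open>\<open>linear_space\<close> is a pair of two product measures, while
  \<open>Var_avg_coord_le_PiM\<close> expects a single one. Indexing by a disjoint sum bridges the
  two: the restrictions to the \<open>Inl\<close> and \<open>Inr\<close> parts are independent and
  have the desired laws, which settles all measurable rectangles.\<close>

lemma distr_PiM_Plus:
  fixes K :: "'i + 'j \<Rightarrow> 'v measure"
  assumes K: "\<And>t. t \<in> I <+> J \<Longrightarrow> prob_space (K t)" and ne: "I <+> J \<noteq> {}"
  shows "distr (PiM (I <+> J) K) (PiM I (\<lambda>i. K (Inl i)) \<Otimes>\<^sub>M PiM J (\<lambda>j. K (Inr j)))
      (\<lambda>\<omega>. (\<lambda>i\<in>I. \<omega> (Inl i), \<lambda>j\<in>J. \<omega> (Inr j)))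
    = PiM I (\<lambda>i. K (Inl i)) \<Otimes>\<^sub>M PiM J (\<lambda>j. K (Inr j))"
proof -
  let ?P = "PiM (I <+> J) K"
  let ?A = "PiM I (\<lambda>i. K (Inl i))" and ?B = "PiM J (\<lambda>j. K (Inr j))"
  interpret prob_space ?P using K by (rule prob_space_PiM)
  have L: "distr ?P ?A (\<lambda>\<omega>. \<lambda>i\<in>I. \<omega> (Inl i)) = ?A" and R: "distr ?P ?B (\<lambda>\<omega>. \<lambda>j\<in>J. \<omega> (Inr j)) = ?B"
    by (rule distr_PiM_reindex[OF K], simp, simp add: inj_on_def, blast)+
  have mL: "(\<lambda>\<omega>. \<lambda>i\<in>I. \<omega> (Inl i)) \<in> PiM (Inl ` I) K \<rightarrow>\<^sub>M ?A"
    and mR: "(\<lambda>\<omega>. \<lambda>j\<in>J. \<omega> (Inr j)) \<in> PiM (Inr ` J) K \<rightarrow>\<^sub>M ?B"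
    by (rule measurable_restrict, rule measurable_component_singleton, blast)+
  have mL': "random_variable ?A (\<lambda>\<omega>. \<lambda>i\<in>I. \<omega> (Inl i))"
    and mR': "random_variable ?B (\<lambda>\<omega>. \<lambda>j\<in>J. \<omega> (Inr j))"
    by (rule measurable_restrict, rule measurable_component_singleton, blast)+
  have ind: "indep_var (PiM (Inl ` I) K) (\<lambda>\<omega>. \<lambda>t\<in>Inl ` I. \<omega> t) (PiM (Inr ` J) K) (\<lambda>\<omega>. \<lambda>t\<in>Inr ` J. \<omega> t)"
    by (rule indep_var_restrict[OF indep_vars_PiM_components[OF K ne]]) auto
  show ?thesis
  proof (rule pair_measure_eqI[symmetric])
    interpret A: prob_space ?A by (rule prob_space_PiM) (use K in auto)
    interpret B: prob_space ?B by (rule prob_space_PiM) (use K in auto)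
    show "sigma_finite_measure ?A" "sigma_finite_measure ?B" by unfold_locales
    fix U V assume U [measurable]: "U \<in> sets ?A" and V [measurable]: "V \<in> sets ?B"
    \<comment> \<open>Independence is available for restrictions to \<open>Inl\<close>
      I\<open>and\<close>Inr \<open>J\<close>, so \<open>U\<close> and \<open>V\<close> are first
      pulled back to functions on these index sets.\<close>
    let ?U = "(\<lambda>\<omega>. \<lambda>i\<in>I. \<omega> (Inl i)) -` U \<inter> space (PiM (Inl ` I) K)"
    let ?V = "(\<lambda>\<omega>. \<lambda>j\<in>J. \<omega> (Inr j)) -` V \<inter> space (PiM (Inr ` J) K)"
    have mU: "?U \<in> sets (PiM (Inl ` I) K)" and mV: "?V \<in> sets (PiM (Inr ` J) K)"
      by (rule measurable_sets[OF mL U], rule measurable_sets[OF mR V])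
    have restr: "restrict \<omega> T \<in> space (PiM T K)" if "\<omega> \<in> space ?P" "T \<subseteq> I <+> J" for \<omega> T
      using measurable_space[OF measurable_restrict_subset[OF that(2)] that(1)] .
    have eU: "(\<lambda>\<omega>. restrict \<omega> (Inl ` I)) -` ?U \<inter> space ?P = (\<lambda>\<omega>. \<lambda>i\<in>I. \<omega> (Inl i)) -` U \<inter> space ?P"
    proof -
      have "(\<lambda>i\<in>I. restrict \<omega> (Inl ` I) (Inl i)) = (\<lambda>i\<in>I. \<omega> (Inl i))" for \<omega> :: "'i + 'j \<Rightarrow> 'v"
        by (rule restrict_ext) simp
      moreover have "restrict \<omega> (Inl ` I) \<in> space (PiM (Inl ` I) K)" if "\<omega> \<in> space ?P" for \<omega>
        using that by (rule restr) auto
      ultimately show ?thesis by (simp only: set_eq_iff vimage_eq Int_iff) blast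
    qed
    have eV: "(\<lambda>\<omega>. restrict \<omega> (Inr ` J)) -` ?V \<inter> space ?P = (\<lambda>\<omega>. \<lambda>j\<in>J. \<omega> (Inr j)) -` V \<inter> space ?P"
    proof -
      have "(\<lambda>j\<in>J. restrict \<omega> (Inr ` J) (Inr j)) = (\<lambda>j\<in>J. \<omega> (Inr j))" for \<omega> :: "'i + 'j \<Rightarrow> 'v"
        by (rule restrict_ext) simp
      moreover have "restrict \<omega> (Inr ` J) \<in> space (PiM (Inr ` J) K)" if "\<omega> \<in> space ?P" for \<omega>
        using that by (rule restr) auto
      ultimately show ?thesis by (simp only: set_eq_iff vimage_eq Int_iff) blast
    qed
    have pair: "(\<lambda>\<omega>. (p \<omega>, q \<omega>)) -` (W \<times> W') \<inter> S = (p -` W \<inter> S) \<inter> (q -` W' \<inter> S)"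
      for p q W W' and S :: "('i + 'j \<Rightarrow> 'v) set"
      by auto
    have "(\<lambda>\<omega>. (\<lambda>i\<in>I. \<omega> (Inl i), \<lambda>j\<in>J. \<omega> (Inr j))) -` (U \<times> V) \<inter> space ?P
        = (\<lambda>\<omega>. (\<lambda>t\<in>Inl ` I. \<omega> t, \<lambda>t\<in>Inr ` J. \<omega> t)) -` (?U \<times> ?V) \<inter> space ?P"
      by (simp only: pair eU eV)
    then have "emeasure (distr ?P (?A \<Otimes>\<^sub>M ?B) (\<lambda>\<omega>. (\<lambda>i\<in>I. \<omega> (Inl i), \<lambda>j\<in>J. \<omega> (Inr j)))) (U \<times> V)
        = ennreal (prob ((\<lambda>\<omega>. (\<lambda>t\<in>Inl ` I. \<omega> t, \<lambda>t\<in>Inr ` J. \<omega> t)) -` (?U \<times> ?V) \<inter> space ?P))"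
      using emeasure_distr[OF measurable_Pair[OF mL' mR'] pair_measureI[OF U V]]
      by (simp only: emeasure_eq_measure)
    also have "\<dots> = ennreal (prob ((\<lambda>\<omega>. \<lambda>i\<in>I. \<omega> (Inl i)) -` U \<inter> space ?P) * prob ((\<lambda>\<omega>. \<lambda>j\<in>J. \<omega> (Inr j)) -` V \<inter> space ?P))"
      using indep_varD[OF ind mU mV] by (simp only: eU eV)
    also have "\<dots> = emeasure (distr ?P ?A (\<lambda>\<omega>. \<lambda>i\<in>I. \<omega> (Inl i))) U * emeasure (distr ?P ?B (\<lambda>\<omega>. \<lambda>j\<in>J. \<omega> (Inr j))) V"
      using mL' mR' by (simp add: emeasure_distr emeasure_eq_measure ennreal_mult)
    finally show "emeasure ?A U * emeasure ?B V
      = emeasure (distr ?P (?A \<Otimes>\<^sub>M ?B) (\<lambda>\<omega>. (\<lambda>i\<in>I. \<omega> (Inl i), \<lambda>j\<in>J. \<omega> (Inr j)))) (U \<times> V)"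
      unfolding L R by simp
  qed simp
qed

text \<open>Adding s mod b is injective on {0, ..., b-1}, hence a bijection, so exactly one shift
  produces the digit d.\<close>

lemma measure_uniform_shift_mod:
  fixes b d s :: nat
  assumes d: "d < b"
  shows "measure (pmf_of_set {..<b}) {v. (s + v) mod b = d} = 1 / real b"
proof -
  have le: "w \<le> v" if "w < b" "(s + w) mod b = (s + v) mod b" for v w
  proof (rule ccontr)
    assume "\<not> w \<le> v"
    then have "b dvd (s + w) - (s + v)"
      using mod_eq_dvd_iff_nat[of "s + v" "s + w" b] that(2) by simp
    then have "b dvd w - v" by simp
    then show False using nat_dvd_not_less[of "w - v" b] that(1) \<open>\<not> w \<le> v\<close> by simp
  qed
  have inj: "inj_on (\<lambda>v. (s + v) mod b) {..<b}"
  proof (rule inj_onI)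
    fix v w assume "v \<in> {..<b}" "w \<in> {..<b}" "(s + v) mod b = (s + w) mod b"
    then show "v = w" using le[of v w] le[of w v] by (simp only: lessThan_iff antisym)
  qed
  have "(\<lambda>v. (s + v) mod b) ` {..<b} = {..<b}"
    by (rule endo_inj_surj[OF _ _ inj]) (use d in auto)
  then have "d \<in> (\<lambda>v. (s + v) mod b) ` {..<b}" using d by simp
  then obtain v0 where v0: "v0 < b" "(s + v0) mod b = d" by blast
  have "{..<b} \<inter> {v. (s + v) mod b = d} = {v0}"
  proof (intro equalityI subsetI)
    fix v assume "v \<in> {..<b} \<inter> {v. (s + v) mod b = d}"
    then show "v \<in> {v0}" using inj_onD[OF inj, of v v0] v0 by simp
  qed (use v0 in simp)
  moreover have "{..<b} \<noteq> {}" using d by auto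
  ultimately show ?thesis by (simp add: measure_pmf_of_set)
qed

lemma Var_linear_scramble_le:
  fixes a :: "nat \<Rightarrow> real ^ 'd" and f :: "real ^ 'd \<Rightarrow> real"
  assumes b: "2 \<le> b"
    and f: "f \<in> borel_measurable borel" "set_integrable lborel unit_cube (\<lambda>x. (f x)\<^sup>2)"
  shows "Var (linear_space b) (\<lambda>\<omega>. (\<Sum>i<n. avg_coord f j (linear_scramble b \<omega> (a i))) / real n)
           \<le> Var (linear_space b) (\<lambda>\<omega>. (\<Sum>i<n. f (linear_scramble b \<omega> (a i))) / real n)"
proof -
  define I where "I = {(k :: 'd, r :: nat, l :: nat). 1 \<le> r \<and> 1 \<le> l \<and> l \<le> r}"
  define J where "J = {(k :: 'd, r :: nat). 1 \<le> r}"
  define K where "K = (\<lambda>t. case t of Inl (k :: 'd, r :: nat, l) \<Rightarrow> measure_pmf (pmf_of_set (if l = r then {1..<b} else {..<b}))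
     | Inr (k :: 'd, r :: nat) \<Rightarrow> measure_pmf (pmf_of_set {..<b}))"
  define A where "A = PiM I (\<lambda>i. K (Inl i))"
  define B where "B = PiM J (\<lambda>i. K (Inr i))"
  \<comment> \<open>The block of coordinate k consists of its matrix entries together with its
    shifts.\<close>
  define c where "c = (\<lambda>k. (I \<inter> {k} \<times> UNIV) <+> (J \<inter> {k} \<times> UNIV))"
  define s where "s = (\<lambda>i (k::'d) r (L :: 'd \<times> nat \<times> nat \<Rightarrow> nat). \<Sum>l=1..Suc r. L (k, Suc r, l) * digit b (a i $ k) l)"
  define D where "D = (\<lambda>i k r (\<omega> :: ('d \<times> nat \<times> nat) + ('d \<times> nat) \<Rightarrow> nat). (s i k r (\<omega> \<circ> Inl) + \<omega> (Inr (k, Suc r))) mod b)"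
  define \<tau> where "\<tau> = (\<lambda>\<omega> :: ('d \<times> nat \<times> nat) + ('d \<times> nat) \<Rightarrow> nat. (\<lambda>i\<in>I. \<omega> (Inl i), \<lambda>j\<in>J. \<omega> (Inr j)))"
  have space_eq: "linear_space b = A \<Otimes>\<^sub>M B"
    unfolding linear_space_def A_def B_def I_def J_def K_def
    by (simp add: case_prod_unfold)
  have K: "prob_space (K t)" for t
    by (auto simp: K_def measure_pmf.prob_space_axioms split: sum.split prod.split)
  have setsK [simp]: "sets (K t) = UNIV" for t by (auto simp: K_def split: sum.split prod.split)
  have spaceK [simp]: "space (K t) = UNIV" for t by (auto simp: K_def split: sum.split prod.split)
  have measK [simp]: "g \<in> K t \<rightarrow>\<^sub>M count_space UNIV" for g :: "nat \<Rightarrow> nat" and t by (simp add: measurable_def)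
  have idK: "(\<lambda>x. x) \<in> K t \<rightarrow>\<^sub>M count_space UNIV" for t by simp
  have mod_meas: "(\<lambda>\<omega>. (g \<omega> + h \<omega>) mod b) \<in> N \<rightarrow>\<^sub>M count_space UNIV"
    if [measurable]: "g \<in> N \<rightarrow>\<^sub>M count_space UNIV" "h \<in> N \<rightarrow>\<^sub>M count_space UNIV"
    for g h :: "(('d \<times> nat \<times> nat) + ('d \<times> nat) \<Rightarrow> nat) \<Rightarrow> nat" and N
    by measurable
  have ne: "I <+> J \<noteq> {}" by (auto simp: J_def)
  have \<tau>: "distr (PiM (I <+> J) K) (A \<Otimes>\<^sub>M B) \<tau> = A \<Otimes>\<^sub>M B"
    unfolding A_def B_def \<tau>_def using K ne by (rule distr_PiM_Plus)
  have compA: "(\<lambda>L. L t) \<in> A \<rightarrow>\<^sub>M count_space UNIV" if "t \<in> I" for t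
    unfolding A_def by (rule measurable_compose[OF measurable_component_singleton[OF that] idK])
  have compB: "(\<lambda>L. L t) \<in> B \<rightarrow>\<^sub>M count_space UNIV" if "t \<in> J" for t
    unfolding B_def by (rule measurable_compose[OF measurable_component_singleton[OF that] idK])
  have IJ: "l \<in> {1..Suc r} \<Longrightarrow> (k, Suc r, l) \<in> I" "(k, Suc r) \<in> J" for k r l by (auto simp: I_def J_def)
  have s_meas [measurable]: "s i k r \<in> A \<rightarrow>\<^sub>M count_space UNIV" for i k r
    unfolding s_def by (intro measurable_sum_nat measurable_compose[OF compA[OF IJ(1)]]) auto
  have c_meas [measurable]: "(\<lambda>v. v (k, Suc r)) \<in> B \<rightarrow>\<^sub>M count_space UNIV" for k r
    using compB IJ by blast
  have \<tau>_meas [measurable]: "\<tau> \<in> PiM (I <+> J) K \<rightarrow>\<^sub>M A \<Otimes>\<^sub>M B"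
    unfolding A_def B_def \<tau>_def
    by (intro measurable_Pair measurable_restrict measurable_component_singleton) auto
  have D_\<tau>: "D i k r \<omega> = (s i k r (fst (\<tau> \<omega>)) + snd (\<tau> \<omega>) (k, Suc r)) mod b" for i k r \<omega>
    using IJ by (auto simp: D_def s_def \<tau>_def intro!: arg_cong[where f="\<lambda>x. (x + _) mod b"] sum.cong)
  have lin: "linear_scramble b (\<tau> \<omega>) (a i) = (\<chi> k. \<Sum>r. real (D i k r \<omega>) / real b ^ Suc r)" for \<omega> i
    unfolding linear_scramble_def D_\<tau> s_def by simp
  have "Var (PiM (I <+> J) K) (\<lambda>\<omega>. (\<Sum>i<n. avg_coord f j (\<chi> k. \<Sum>r. real (D i k r \<omega>) / real b ^ Suc r)) / real n)
      \<le> Var (PiM (I <+> J) K) (\<lambda>\<omega>. (\<Sum>i<n. f (\<chi> k. \<Sum>r. real (D i k r \<omega>) / real b ^ Suc r)) / real n)"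
  proof (rule Var_avg_coord_le_PiM[where c=c, OF K ne _ _ b _ _ _ _ f])
    show "c k \<subseteq> I <+> J" for k by (auto simp: c_def)
    show "disjoint_family c" by (auto simp: disjoint_family_on_def c_def)
    fix i k r
    have in_c: "l \<in> {1..Suc r} \<Longrightarrow> Inl (k, Suc r, l) \<in> c k" "Inr (k, Suc r) \<in> c k" for l
      using IJ by (auto simp: c_def)
    have comp: "(\<lambda>\<omega>. \<omega> t) \<in> PiM (c k) K \<rightarrow>\<^sub>M count_space UNIV" if "t \<in> c k" for t
      by (rule measurable_compose[OF measurable_component_singleton[OF that] idK])
    show "D i k r \<in> PiM (c k) K \<rightarrow>\<^sub>M count_space UNIV"
    proof -
      have "(\<lambda>\<omega>. s i k r (\<omega> \<circ> Inl)) \<in> PiM (c k) K \<rightarrow>\<^sub>M count_space UNIV"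
        unfolding s_def comp_def by (intro measurable_sum_nat measurable_compose[OF comp[OF in_c(1)]]) auto
      moreover have "(\<lambda>\<omega>. \<omega> (Inr (k, Suc r))) \<in> PiM (c k) K \<rightarrow>\<^sub>M count_space UNIV"
        by (rule comp[OF in_c(2)])
      ultimately show ?thesis unfolding D_def by (rule mod_meas)
    qed
    show "D i k r (restrict \<omega> (c k)) = D i k r \<omega>" for \<omega>
      using in_c by (auto simp: D_def s_def intro!: arg_cong[where f="\<lambda>x. (x + _) mod b"] sum.cong)
    show "AE \<omega> in PiM (I <+> J) K. D i k r \<omega> < b"
      using b by (auto simp: D_def)
  next
    fix i k R and d :: "nat \<Rightarrow> nat" assume d: "\<And>r. r < R \<Longrightarrow> d r < b"
    interpret B: product_prob_space "\<lambda>i. K (Inr i)" J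
      using K by (intro product_prob_spaceI)
    interpret A: prob_space A unfolding A_def by (rule prob_space_PiM) (rule K)
    interpret B': prob_space B unfolding B_def by (rule prob_space_PiM) (rule K)
    let ?E = "{z \<in> space (A \<Otimes>\<^sub>M B). \<forall>r<R. (s i k r (fst z) + snd z (k, Suc r)) mod b = d r}"
    have E [measurable]: "?E \<in> sets (A \<Otimes>\<^sub>M B)" by measurable
    \<comment> \<open>For a frozen matrix the event prescribes R different shifts one residue each,
      so its probability does not depend on \<open>L\<close> and integrating over \<open>L\<close>
      is trivial.\<close>
    have inner: "emeasure B (Pair L -` ?E) = ennreal (1 / real b ^ R)" if L: "L \<in> space A" for L
    proof -
      \<comment> \<open>Shifts are indexed from 1 and output digits from 0, hence
        \<open>snd t - 1\<close>.\<close>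
      define Y where "Y = (\<lambda>t :: 'd \<times> nat. {v. (s i k (snd t - 1) L + v) mod b = d (snd t - 1)})"
      let ?J = "(\<lambda>r. (k, Suc r)) ` {..<R}"
      have inj: "inj_on (\<lambda>r. (k, Suc r)) {..<R}" by (auto simp: inj_on_def)
      have "Pair L -` ?E = {v \<in> space B. \<forall>t\<in>?J. v t \<in> Y t}"
        using L by (auto simp: space_pair_measure Y_def)
      then have "emeasure B (Pair L -` ?E) = (\<Prod>t\<in>?J. emeasure (K (Inr t)) (Y t))"
        unfolding B_def by (simp only:) (rule B.emeasure_PiM_Collect, auto simp: J_def)
      also have "\<dots> = (\<Prod>r<R. emeasure (measure_pmf (pmf_of_set {..<b})) {v. (s i k r L + v) mod b = d r})"
        by (simp add: prod.reindex[OF inj] K_def Y_def)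
      also have "\<dots> = (\<Prod>r<R. ennreal (1 / real b))"
        using d by (intro prod.cong refl) (simp add: measure_pmf.emeasure_eq_measure measure_uniform_shift_mod)
      also have "\<dots> = ennreal (1 / real b ^ R)"
        using b by (simp add: ennreal_power power_one_over)
      finally show ?thesis .
    qed
    have "emeasure (PiM (I <+> J) K) {\<omega> \<in> space (PiM (I <+> J) K). \<forall>r<R. D i k r \<omega> = d r}
        = emeasure (distr (PiM (I <+> J) K) (A \<Otimes>\<^sub>M B) \<tau>) ?E"
      by (subst emeasure_distr)
        (use measurable_space[OF \<tau>_meas] in \<open>auto simp: D_\<tau> intro!: arg_cong[where f="emeasure _"]\<close>)
    also have "\<dots> = (\<integral>\<^sup>+L. emeasure B (Pair L -` ?E) \<partial>A)"
      unfolding \<tau> by (rule B'.emeasure_pair_measure_alt[OF E])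
    also have "\<dots> = (\<integral>\<^sup>+L. ennreal (1 / real b ^ R) \<partial>A)"
      by (rule nn_integral_cong) (rule inner)
    also have "\<dots> = ennreal (1 / real b ^ R)"
      by (simp add: A.emeasure_space_1)
    finally show "measure (PiM (I <+> J) K) {\<omega> \<in> space (PiM (I <+> J) K). \<forall>r<R. D i k r \<omega> = d r} = 1 / real b ^ R"
      by (simp add: measure_def)
  qed
  \<comment> \<open>Change of variables along \<open>\<tau>\<close> carries the inequality from the
    single product measure back to \<open>linear_space\<close>.\<close>
  moreover have "Var (linear_space b) h = Var (PiM (I <+> J) K) (\<lambda>\<omega>. h (\<tau> \<omega>))"
    if h: "h \<in> borel_measurable (A \<Otimes>\<^sub>M B)" for h
  proof -
    have "(\<integral>z. g z \<partial>linear_space b) = (\<integral>\<omega>. g (\<tau> \<omega>) \<partial>PiM (I <+> J) K)"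
      if "g \<in> borel_measurable (A \<Otimes>\<^sub>M B)" for g :: "_ \<Rightarrow> real"
      unfolding space_eq by (subst \<tau>[symmetric]) (rule integral_distr[OF \<tau>_meas that])
    then show ?thesis unfolding Var_def using h by simp
  qed
  moreover have "(\<lambda>\<omega>. linear_scramble b \<omega> (a i)) \<in> borel_measurable (A \<Otimes>\<^sub>M B)" for i
  proof (rule borel_measurable_vecI)
    fix k
    have "(\<lambda>z. \<Sum>r. real ((s i k r (fst z) + snd z (k, Suc r)) mod b) / real b ^ Suc r) \<in> borel_measurable (A \<Otimes>\<^sub>M B)"
      by measurable
    then show "(\<lambda>\<omega>. linear_scramble b \<omega> (a i) $ k) \<in> borel_measurable (A \<Otimes>\<^sub>M B)"
      by (simp add: linear_scramble_def s_def)
  qed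
  ultimately show ?thesis
    using f(1) by (simp add: lin)
qed

theorem theorem1:
  fixes b n :: nat and a :: "nat \<Rightarrow> real ^ 'd" and f :: "real ^ 'd \<Rightarrow> real" and j :: 'd
  assumes "b \<ge> 2"
    and "\<forall>i<n. a i \<in> unit_cube"
    and "f \<in> borel_measurable borel"
    and "set_integrable lborel unit_cube (\<lambda>x. (f x)\<^sup>2)"
  shows "Var (nested_space b) (\<lambda>\<pi>. (\<Sum>i<n. avg_coord f j (nested_scramble b \<pi> (a i))) / real n)
           \<le> Var (nested_space b) (\<lambda>\<pi>. (\<Sum>i<n. f (nested_scramble b \<pi> (a i))) / real n)
       \<and> (prime b \<longrightarrow>
          Var (linear_space b) (\<lambda>\<omega>. (\<Sum>i<n. avg_coord f j (linear_scramble b \<omega> (a i))) / real n)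
           \<le> Var (linear_space b) (\<lambda>\<omega>. (\<Sum>i<n. f (linear_scramble b \<omega> (a i))) / real n))"
  using Var_nested_scramble_le[OF assms(1,3,4)] Var_linear_scramble_le[OF assms(1,3,4)] by blast

end
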